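(* Let $t\in[0,1)$ and let $\Theta_t(z)=\left(\frac{z-t}{1-tz}\right)^5$. Then $M_{\Theta_t}$ satisfies the level set Crouzeix conjecture; that is, for every finite Blaschke product $B$ with $\deg B<5$, one has $W(M_{\Theta_t})\not\subseteq\Omega^B_{1/2}$.
   Context: $\mathbb{D}$ is the open unit disk in $\mathbb{C}$ and $\mathbb{T}$ the unit circle. For an $n\times n$ complex matrix $A$, the numerical range is $W(A)=\{\langle Ax,x\rangle : x\in\mathbb{C}^n,\ \|x\|=1\}$. A finite Blaschke product of degree $d$ is a rational function $B(z)=\lambda\prod_{j=1}^d\frac{z-b_j}{1-\overline{b_j}z}$ with $\lambda\in\mathbb{T}$ and $b_1,\dots,b_d\in\mathbb{D}$. Its $1/2$-level set is $\Omega^B_{1/2}=\{z\in\mathbb{C}:|B(z)|<\tfrac12\}$. For $\Theta_t(z)=\left(\frac{z-t}{1-tz}\right)^n$ with $t\in[0,1)$, $M_{\Theta_t}$ is the upper triangular $n\times n$ matrix with diagonal entries $t$, entries $0$ below the diagonal, and entries $(M_{\Theta_t})_{ij}=(1-t^2)(-t)^{j-i-1}$ for $i<j$ (with $(-t)^0=1$). Here $n=5$. *)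

theory Defs
  imports
    "HOL-Complex_Analysis.Complex_Analysis"
    "Jordan_Normal_Form.Matrix"
begin

definition vec_norm :: "complex vec \<Rightarrow> real" where
  "vec_norm x = sqrt (Re (x \<bullet>c x))"

definition numerical_range :: "complex mat \<Rightarrow> complex set" where
  "numerical_range A =
    {(A *\<^sub>v x) \<bullet>c x | x. x \<in> carrier_vec (dim_row A) \<and> vec_norm x = 1}"

(* The empty product is allowed: degree 0 means a unimodular constant. *)
definition finite_blaschke_product :: "nat \<Rightarrow> (complex \<Rightarrow> complex) \<Rightarrow> bool" where
  "finite_blaschke_product d B \<longleftrightarrow>
    (\<exists>c b. cmod c = 1 \<and> (\<forall>j<d. cmod (b j) < 1) \<and>
      B = (\<lambda>z. c * (\<Prod>j<d. (z - b j) / (1 - cnj (b j) * z))))"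

(* A rational function is represented by a total function, which by the convention
   x / 0 = 0 vanishes at its poles; there the modulus is infinite, so that poles never
   belong to the level set and have to be removed explicitly. *)
definition level_set :: "real \<Rightarrow> (complex \<Rightarrow> complex) \<Rightarrow> complex set" where
  "level_set r B = {z. \<not> is_pole B z \<and> cmod (B z) < r}"

(* The matrix M_Theta for Theta z = ((z - t) / (1 - t * z)) ^ n. Indices start at 0,
   which leaves j - i unchanged. *)
definition M_Theta :: "nat \<Rightarrow> real \<Rightarrow> complex mat" where
  "M_Theta n t = mat n n (\<lambda>(i, j).
     if i = j then of_real t
     else if i < j then of_real ((1 - t\<^sup>2) * (- t) ^ (j - i - 1))
     else 0)"

definition level_set_crouzeix :: "complex mat \<Rightarrow> bool" where
  "level_set_crouzeix A \<longleftrightarrow>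
    (\<forall>d B. d < dim_row A \<longrightarrow> finite_blaschke_product d B \<longrightarrow>
      \<not> numerical_range A \<subseteq> level_set (1 / 2) B)"

end

theory Submission
  imports Defs
begin

text \<open>
  Write \<open>M = \<phi>(J)\<close> with \<open>J\<close> the nilpotent Jordan block and
  \<open>\<phi>(z) = (z + t) / (1 + t z)\<close>. For a fixed unit vector \<open>x\<close>, conjugating
  \<open>J\<close> with \<open>diag(1, z, \<dots>, z^4)\<close>, \<open>|z| = 1\<close>, shows that
  \<open>F(z) = \<langle>\<phi>(z J) x, x\<rangle>\<close>, a polynomial in \<open>z\<close>, maps the
  unit circle into \<open>W(M)\<close>. For \<open>x\<close> proportional to \<open>(1, 2, 2, 2,
  1)\<close>, close to the vector attaining the numerical radius of \<open>J\<close>, the curve stays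
  outside the pseudohyperbolic disk \<open>U\<close> of radius \<open>16 / 19\<close> about \<open>c = 5
  t / (3 + 2 t\<^sup>2)\<close>. As \<open>F(0) = t\<close> lies in \<open>U\<close>, the open mapping
  theorem and connectedness give \<open>U \<subseteq> F(D)\<close>, \<open>D\<close> the unit disk. If
  \<open>|B| < 1/2\<close> on \<open>W(M)\<close>, the maximum principle for \<open>B \<circ> F\<close>
  yields \<open>|B| \<le> 1/2\<close> on \<open>U\<close>. But on the boundary of a pseudohyperbolic disk
  of radius \<open>r\<close> a Blaschke product of degree \<open>d\<close> attains modulus at least
  \<open>r^d\<close>, and \<open>(16 / 19)^4 > 1/2\<close>.
\<close>

section \<open>Blaschke products on circles about the origin\<close>

lemma one_minus_mult_nonzero:
  assumes "cmod a < 1" "cmod z \<le> 1"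
  shows "1 - a * z \<noteq> 0"
proof
  assume "1 - a * z = 0"
  then have "cmod a * cmod z = 1"
    by (metis eq_iff_diff_eq_0 norm_mult norm_one)
  moreover have "cmod a * cmod z \<le> cmod a * 1"
    using assms by (intro mult_left_mono) auto
  ultimately show False using assms by simp
qed

text \<open>On the circle \<open>r^2 = z * cnj z\<close>. This trades a zero \<open>b\<close> inside
  the circle for its reflection \<open>r^2 / cnj b\<close> outside it.\<close>

lemma blaschke_factor_cmod_eq:
  assumes "cmod z = r"
  shows "cmod (of_real (r^2) - cnj b * z) = r * cmod (z - b)"
proof -
  have "of_real (r^2) - cnj b * z = z * cnj (z - b)"
    using assms complex_norm_square[of z] by (simp add: algebra_simps)
  then show ?thesis using assms by (simp add: norm_mult del: complex_cnj_diff)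
qed

text \<open>Replacing each factor with a zero in the disk by one of the same modulus on the circle
  \<open>cmod z = r\<close> and with value \<open>r\<close> at \<open>0\<close> leaves a function to which
  the maximum principle applies.\<close>
lemma blaschke_circle_bound:
  assumes r: "0 < r" "r < 1" and b: "\<And>j. j < d \<Longrightarrow> cmod (b j) < 1"
    and K: "\<And>z. cmod z = r \<Longrightarrow> (\<Prod>j<d. cmod (z - b j) / cmod (1 - cnj (b j) * z)) \<le> K"
  shows "r ^ d \<le> K"
proof -
  define f where "f = (\<lambda>j z. if cmod (b j) < r
    then (of_real (r^2) - cnj (b j) * z) / (of_real r * (1 - cnj (b j) * z))
    else (z - b j) / (1 - cnj (b j) * z))"
  have nz: "1 - cnj (b j) * z \<noteq> 0" if "j < d" "cmod z \<le> r" for j z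
    using one_minus_mult_nonzero[of "cnj (b j)" z] b[OF that(1)] that(2) r by simp
  have hol: "(\<lambda>z. \<Prod>j<d. f j z) holomorphic_on cball 0 r"
  proof (rule holomorphic_on_prod)
    fix j assume j: "j \<in> {..<d}"
    show "f j holomorphic_on cball 0 r"
      unfolding f_def using r j nz
      by (cases "cmod (b j) < r") (auto intro!: holomorphic_intros)
  qed
  have eq: "cmod (f j z) = cmod (z - b j) / cmod (1 - cnj (b j) * z)" if "cmod z = r" for j z
    using r blaschke_factor_cmod_eq[OF that, of "b j"]
    by (simp add: f_def norm_divide norm_mult)
  have "cmod (\<Prod>j<d. f j 0) \<le> K"
  proof (rule maximum_modulus_frontier[of "\<lambda>z. \<Prod>j<d. f j z" "cball 0 r"])
    show "(\<lambda>z. \<Prod>j<d. f j z) holomorphic_on interior (cball 0 r)"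
      using hol holomorphic_on_subset interior_subset by blast
    show "continuous_on (closure (cball 0 r)) (\<lambda>z. \<Prod>j<d. f j z)"
      using hol by (simp add: holomorphic_on_imp_continuous_on)
    show "cmod (\<Prod>j<d. f j z) \<le> K" if "z \<in> frontier (cball 0 r)" for z
    proof -
      have "cmod z = r" using that by (simp add: frontier_cball)
      then show ?thesis using K[of z] eq by (simp add: prod_norm[symmetric])
    qed
  qed (use r in auto)
  moreover have "r ^ d \<le> (\<Prod>j<d. cmod (f j 0))"
  proof -
    \<comment> \<open>At 0 a reflected factor has modulus \<open>r\<close>, any other one
      \<open>cmod (b j) \<ge> r\<close>.\<close>
    have "(\<Prod>j<d. r) \<le> (\<Prod>j<d. cmod (f j 0))"
      using r by (intro prod_mono) (auto simp: f_def norm_divide power2_eq_square)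
    then show ?thesis by simp
  qed
  ultimately show ?thesis by (simp add: prod_norm[symmetric])
qed

section \<open>Transport to pseudohyperbolic disks\<close>

text \<open>For \<open>\<bar>c\<bar> < 1\<close> this is an automorphism of the unit disk taking 0
  to \<open>c\<close>; it maps \<open>cball 0 r\<close> with \<open>r < 1\<close> onto the closed
  pseudohyperbolic disk of radius \<open>r\<close> about \<open>c\<close>.\<close>

definition disk_map :: "real \<Rightarrow> complex \<Rightarrow> complex" where
  "disk_map c z = (z + of_real c) / (1 + of_real c * z)"

lemma disk_map_denominator_nonzero:
  assumes "\<bar>c\<bar> < 1" "cmod z \<le> 1"
  shows "1 + of_real c * z \<noteq> 0"
  using one_minus_mult_nonzero[of "- of_real c" z] assms by simp

text \<open>Disk automorphisms preserve the pseudohyperbolic distance. Here \<open>\<beta>\<close>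
  is the preimage of \<open>b\<close>, and numerator and denominator pick up the factors
  \<open>1 - c * b\<close> and its conjugate, which have equal modulus.\<close>

lemma blaschke_factor_disk_map:
  fixes c :: real
  assumes c: "\<bar>c\<bar> < 1" and b: "cmod b < 1" and z: "1 + of_real c * z \<noteq> 0"
  defines "\<beta> \<equiv> (b - of_real c) / (1 - of_real c * b)"
  defines "w \<equiv> disk_map c z"
  shows "cmod \<beta> < 1"
    and "cmod (w - b) / cmod (1 - cnj b * w) = cmod (z - \<beta>) / cmod (1 - cnj \<beta> * z)"
proof -
  have "\<bar>c\<bar> * cmod b \<le> 1 * cmod b"
    using c by (intro mult_right_mono) auto
  then have "cmod (of_real c * b) < 1"
    using b by (simp add: norm_mult)
  then have n: "1 - of_real c * b \<noteq> 0" by auto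
  show "cmod \<beta> < 1"
    using Moebius_function_norm_lt_1[of "of_real c" b 0] c b
    by (simp add: Moebius_function_def \<beta>_def)
  have \<beta>: "(1 - of_real c * b) * \<beta> = b - of_real c" using n by (simp add: \<beta>_def)
  have \<beta>': "(1 - of_real c * cnj b) * cnj \<beta> = cnj b - of_real c"
    using arg_cong[OF \<beta>, of cnj] by simp
  have w: "w * (1 + of_real c * z) = z + of_real c" using z by (simp add: w_def disk_map_def)
  have "(w - b) * (1 + of_real c * z) = (1 - of_real c * b) * (z - \<beta>)"
    \<comment> \<open>qualified because HOL-Algebra redefines the method name\<close>
    using \<beta> w by Groebner_Basis.algebra
  then have 1: "w - b = (1 - of_real c * b) * (z - \<beta>) / (1 + of_real c * z)"
    using z by (simp add: nonzero_eq_divide_eq)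
  have "(1 - cnj b * w) * (1 + of_real c * z) = (1 - of_real c * cnj b) * (1 - cnj \<beta> * z)"
    using \<beta>' w by Groebner_Basis.algebra
  then have 2: "1 - cnj b * w = cnj (1 - of_real c * b) * (1 - cnj \<beta> * z) / (1 + of_real c * z)"
    using z by (simp add: nonzero_eq_divide_eq)
  show "cmod (w - b) / cmod (1 - cnj b * w) = cmod (z - \<beta>) / cmod (1 - cnj \<beta> * z)"
    unfolding 1 2 norm_divide norm_mult complex_mod_cnj using n z by simp
qed

text \<open>\<open>B\<close> composed with \<open>disk_map c\<close> has the modulus of a Blaschke
  product of the same degree with zeros \<open>\<beta> j\<close>, so the bound on circles about 0
  applies.\<close>

lemma blaschke_disk_bound:
  assumes B: "finite_blaschke_product d B" and c: "\<bar>c\<bar> < 1" and r: "0 < r" "r < 1"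
    and K: "\<And>z. cmod z = r \<Longrightarrow> cmod (B (disk_map c z)) \<le> K"
  shows "r ^ d \<le> K"
proof -
  obtain l b where l: "cmod l = 1" and b: "\<And>j. j < d \<Longrightarrow> cmod (b j) < 1"
    and Bdef: "B = (\<lambda>z. l * (\<Prod>j<d. (z - b j) / (1 - cnj (b j) * z)))"
    using B unfolding finite_blaschke_product_def by blast
  define \<beta> where "\<beta> = (\<lambda>j. (b j - of_real c) / (1 - of_real c * b j))"
  show ?thesis
  proof (rule blaschke_circle_bound[of r d \<beta>])
    show "cmod (\<beta> j) < 1" if "j < d" for j
      unfolding \<beta>_def using blaschke_factor_disk_map(1)[OF c b[OF that], of 0] by simp
    show "(\<Prod>j<d. cmod (z - \<beta> j) / cmod (1 - cnj (\<beta> j) * z))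
        \<le> K" if z: "cmod z = r" for z
    proof -
      have nz: "1 + of_real c * z \<noteq> 0"
        using disk_map_denominator_nonzero[OF c] z r by simp
      have "(\<Prod>j<d. cmod (z - \<beta> j) / cmod (1 - cnj (\<beta> j) * z)) = cmod (B (disk_map c z))"
        unfolding Bdef norm_mult l prod_norm[symmetric] norm_divide
        using blaschke_factor_disk_map(2)[OF c b nz] by (simp add: \<beta>_def)
      then show ?thesis using K[OF z] by simp
    qed
  qed (use r in auto)
qed

section \<open>The polynomial inequality separating the curve from the disk\<close>

text \<open>The hypotheses state, up to binomial factors, that the Bernstein coefficients of the quartic on
  \<open>[0, 1]\<close> are nonnegative.\<close>
lemma quartic_nonneg:
  fixes u a0 a1 a2 a3 a4 :: real
  assumes u: "0 \<le> u" "u \<le> 1"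
    and "0 \<le> a0" "0 \<le> 4 * a0 + a1" "0 \<le> 6 * a0 + 3 * a1 + a2"
    and "0 \<le> 4 * a0 + 3 * a1 + 2 * a2 + a3" "0 \<le> a0 + a1 + a2 + a3 + a4"
  shows "0 \<le> a0 + a1 * u + a2 * u^2 + a3 * u^3 + a4 * u^4"
proof -
  have "a0 + a1 * u + a2 * u^2 + a3 * u^3 + a4 * u^4 =
      a0 * (1 - u)^4 + (4 * a0 + a1) * (u * (1 - u)^3)
      + (6 * a0 + 3 * a1 + a2) * (u^2 * (1 - u)^2)
      + (4 * a0 + 3 * a1 + 2 * a2 + a3) * (u^3 * (1 - u)) + (a0 + a1 + a2 + a3 + a4) * u^4"
    by Groebner_Basis.algebra
  moreover have "0 \<le> a0 * (1 - u)^4" "0 \<le> (4 * a0 + a1) * (u * (1 - u)^3)"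
    "0 \<le> (6 * a0 + 3 * a1 + a2) * (u^2 * (1 - u)^2)"
    "0 \<le> (4 * a0 + 3 * a1 + 2 * a2 + a3) * (u^3 * (1 - u))"
    "0 \<le> (a0 + a1 + a2 + a3 + a4) * u^4"
    using assms by simp_all
  ultimately show ?thesis by linarith
qed

text \<open>The right-hand sides below are nonnegative combinations of products of \<open>t\<close> and \<open>1 - t\<close>; they were
  found by linear programming.\<close>
lemma separation_polynomial_nonneg:
  fixes a t :: real
  assumes t: "0 \<le> t" "t \<le> 1" and a: "-1 \<le> a" "a \<le> 1"
  shows "0 \<le> (252 + 4960 * t^2 - 1852 * t^4 - 49 * t^6 - 41 * t^8 + 28 * t^10)
     + (- 1008 * t - 12120 * t^3 + 3200 * t^5 + 552 * t^7 - 224 * t^9) * a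
     + (- 2688 * t^2 + 14080 * t^4 - 2208 * t^6 + 896 * t^8) * a^2
     + (8736 * t^3 - 8608 * t^5 - 2688 * t^7) * a^3
     + (- 7392 * t^4 + 6272 * t^6) * a^4"
proof -
  let ?a0 = "252 + 4960 * t^2 - 1852 * t^4 - 49 * t^6 - 41 * t^8 + 28 * t^10"
  have "?a0 =
    252 + 3018 * t^2 + 1942 * t^2 * (1 - t) + 1942 * t^3 * (1 - t) + 90 * t^4 * (1 - t)
    + 90 * t^5 * (1 - t) + 41 * t^6 * (1 - t) + 41 * t^7 * (1 - t) + 28 * t^10"
    by Groebner_Basis.algebra
  also have "\<dots> \<ge> 0"
    using t by (intro add_nonneg_nonneg mult_nonneg_nonneg zero_le_power) auto
  finally have a0: "0 \<le> ?a0" .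
  show ?thesis
  proof (cases "0 \<le> a")
    case True
    then show ?thesis
    proof (rule quartic_nonneg)
      show "a \<le> 1" by (fact a(2))
      let ?a1 = "- 1008 * t - 12120 * t^3 + 3200 * t^5 + 552 * t^7 - 224 * t^9"
      let ?a2 = "- 2688 * t^2 + 14080 * t^4 - 2208 * t^6 + 896 * t^8"
      let ?a3 = "8736 * t^3 - 8608 * t^5 - 2688 * t^7"
      let ?a4 = "- 7392 * t^4 + 6272 * t^6"
      show "0 \<le> ?a0" by (fact a0)
      have "4 * ?a0 + ?a1 =
        1008 * (1 - t) + 312 * t^2 + 19528 * t^2 * (1 - t) + 7408 * t^3 * (1 - t) + 3004 * t^5
        + 196 * t^5 * (1 - t) + 164 * t^7 + 388 * t^7 * (1 - t) + 224 * t^8 * (1 - t) + 112 * t^10"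
        by Groebner_Basis.algebra
      also have "\<dots> \<ge> 0"
        using t by (intro add_nonneg_nonneg mult_nonneg_nonneg zero_le_power) auto
      finally show "0 \<le> 4 * ?a0 + ?a1" .
      have "6 * ?a0 + 3 * ?a1 + ?a2 =
        1512 * (1 - t)^2 + 6928 * t^2 * (1 - t) + 18632 * t^2 * (1 - t)^2 + 7832 * t^3 * (1 - t)^2
        + 1034 * t^5 * (1 - t) + 734 * t^5 * (1 - t)^2 + 900 * t^7 + 22 * t^7 * (1 - t)
        + 672 * t^8 * (1 - t) + 168 * t^10"
        by Groebner_Basis.algebra
      also have "\<dots> \<ge> 0"
        using t by (intro add_nonneg_nonneg mult_nonneg_nonneg zero_le_power) auto
      finally show "0 \<le> 6 * ?a0 + 3 * ?a1 + ?a2" .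
      have "4 * ?a0 + 3 * ?a1 + 2 * ?a2 + ?a3 =
        1008 * (1 - t)^3 + 7704 * t^2 * (1 - t)^2 + 3736 * t^2 * (1 - t)^3 + 924 * t^4
        + 916 * t^4 * (1 - t) + 5644 * t^5 * (1 - t) + 1032 * t^6 * (1 - t) + 956 * t^8
        + 672 * t^8 * (1 - t) + 112 * t^10"
        by Groebner_Basis.algebra
      also have "\<dots> \<ge> 0"
        using t by (intro add_nonneg_nonneg mult_nonneg_nonneg zero_le_power) auto
      finally show "0 \<le> 4 * ?a0 + 3 * ?a1 + 2 * ?a2 + ?a3" .
      have "?a0 + ?a1 + ?a2 + ?a3 + ?a4 =
        252 * (1 - t)^4 + 664 * t^2 * (1 - t)^3 + 96 * t^2 * (1 - t)^4 + 1688 * t^4 * (1 - t)^2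
        + 328 * t^4 * (1 - t)^3 + 686 * t^6 * (1 - t) + 561 * t^6 * (1 - t)^2 + 70 * t^8
        + 224 * t^8 * (1 - t) + 28 * t^10"
        by Groebner_Basis.algebra
      also have "\<dots> \<ge> 0"
        using t by (intro add_nonneg_nonneg mult_nonneg_nonneg zero_le_power) auto
      finally show "0 \<le> ?a0 + ?a1 + ?a2 + ?a3 + ?a4" .
    qed
  next
    case False
    then have "0 \<le> - a" by simp
    \<comment> \<open>The quartic is rewritten in \<open>- a\<close>, which lies in [0, 1]; its odd
      coefficients change sign.\<close>
    let ?a1 = "1008 * t + 12120 * t^3 - 3200 * t^5 - 552 * t^7 + 224 * t^9"
    let ?a2 = "- 2688 * t^2 + 14080 * t^4 - 2208 * t^6 + 896 * t^8"
    let ?a3 = "- 8736 * t^3 + 8608 * t^5 + 2688 * t^7"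
    let ?a4 = "- 7392 * t^4 + 6272 * t^6"
    have "0 \<le> ?a0 + ?a1 * (- a) + ?a2 * (- a)^2 + ?a3 * (- a)^3 + ?a4 * (- a)^4"
      using \<open>0 \<le> - a\<close>
    proof (rule quartic_nonneg)
      show "- a \<le> 1" using a by simp
      show "0 \<le> ?a0" by (fact a0)
      have "4 * ?a0 + ?a1 =
        1008 + 1008 * t + 19840 * t^2 + 600 * t^3 + 11520 * t^3 * (1 - t) + 4112 * t^4 * (1 - t)
        + 912 * t^5 * (1 - t) + 716 * t^6 * (1 - t) + 164 * t^7 * (1 - t) + 224 * t^9 + 112 * t^10"
        by Groebner_Basis.algebra
      also have "\<dots> \<ge> 0"
        using t by (intro add_nonneg_nonneg mult_nonneg_nonneg zero_le_power) auto
      finally show "0 \<le> 4 * ?a0 + ?a1" .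
      have "6 * ?a0 + 3 * ?a1 + ?a2 =
        1512 + 3024 * t + 27072 * t^2 + 25570 * t^3 + 10790 * t^3 * (1 - t) + 13758 * t^4 * (1 - t)
        + 4158 * t^5 * (1 - t) + 1656 * t^6 * (1 - t) + 650 * t^8 + 672 * t^9 + 168 * t^10"
        by Groebner_Basis.algebra
      also have "\<dots> \<ge> 0"
        using t by (intro add_nonneg_nonneg mult_nonneg_nonneg zero_le_power) auto
      finally show "0 \<le> 6 * ?a0 + 3 * ?a1 + ?a2" .
      have "4 * ?a0 + 3 * ?a1 + 2 * ?a2 + ?a3 =
        1008 + 3024 * t + 14464 * t^2 + 27624 * t^3 + 15148 * t^4 + 5604 * t^4 * (1 - t)
        + 4612 * t^5 * (1 - t) + 1032 * t^7 + 1628 * t^8 + 672 * t^9 + 112 * t^10"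
        by Groebner_Basis.algebra
      also have "\<dots> \<ge> 0"
        using t by (intro add_nonneg_nonneg mult_nonneg_nonneg zero_le_power) auto
      finally show "0 \<le> 4 * ?a0 + 3 * ?a1 + 2 * ?a2 + ?a3" .
      have "?a0 + ?a1 + ?a2 + ?a3 + ?a4 =
        252 + 1008 * t + 2272 * t^2 + 3384 * t^3 + 4836 * t^4 + 5408 * t^5 + 4015 * t^6 + 2136 * t^7
        + 855 * t^8 + 224 * t^9 + 28 * t^10"
        by Groebner_Basis.algebra
      also have "\<dots> \<ge> 0"
        using t by (intro add_nonneg_nonneg mult_nonneg_nonneg zero_le_power) auto
      finally show "0 \<le> ?a0 + ?a1 + ?a2 + ?a3 + ?a4" .
    qed
    then show ?thesis by (simp add: algebra_simps)
  qed
qed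

text \<open>With \<open>F = t + (1 - t^2) * p / 14\<close> and
  \<open>c = 5 * t / (3 + 2 * t^2)\<close>, the left side is a positive multiple of
  \<open>7 * |F - c|^2 - 5 * |1 - c * F|^2\<close> when \<open>t^2 < 1\<close>. On the unit circle
  \<open>Re (z^k)\<close> and \<open>Im (z^k) / Im z\<close> are Chebyshev polynomials in
  \<open>a\<close>, and \<open>(Im z)^2 = 1 - a^2\<close>, so a polynomial in \<open>a\<close>
  results.\<close>

lemma separation_identity:
  fixes t :: real
  assumes z: "cmod z = 1"
  defines "p \<equiv> 12 * z - 8 * of_real t * z^2 + 4 * of_real t^2 * z^3 - of_real t^3 * z^4"
  defines "a \<equiv> Re z"
  shows "7 * (cmod (of_real (3 + 2 * t^2) * p - 28 * of_real t))^2
      - 5 * (cmod (42 - 5 * of_real t * p))^2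
     = (252 + 4960 * t^2 - 1852 * t^4 - 49 * t^6 - 41 * t^8 + 28 * t^10)
     + (- 1008 * t - 12120 * t^3 + 3200 * t^5 + 552 * t^7 - 224 * t^9) * a
     + (- 2688 * t^2 + 14080 * t^4 - 2208 * t^6 + 896 * t^8) * a^2
     + (8736 * t^3 - 8608 * t^5 - 2688 * t^7) * a^3
     + (- 7392 * t^4 + 6272 * t^6) * a^4"
proof -
  define b where "b = Im z"
  have ab: "b^2 = 1 - a^2" using z unfolding a_def b_def by (simp add: cmod_def)
  define A where "A = 12 * a - 8 * t * (2 * a^2 - 1) + 4 * t^2 * (4 * a^3 - 3 * a)
      - t^3 * (8 * a^4 - 8 * a^2 + 1)"
  define q where "q = 12 - 16 * t * a + 4 * t^2 * (4 * a^2 - 1) - t^3 * (8 * a^3 - 4 * a)"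
  have zab: "z = Complex a b" by (simp add: a_def b_def)
  have z2: "z^2 = Complex (2 * a^2 - 1) (2 * a * b)"
    using ab unfolding zab by (simp add: power2_eq_square complex_eq_iff)
  have z3: "z^3 = Complex (4 * a^3 - 3 * a) ((4 * a^2 - 1) * b)"
  proof -
    have "(2 * a^2 - 1) * a - 2 * a * b * b = 4 * a^3 - 3 * a"
      using ab by Groebner_Basis.algebra
    moreover have "z^3 = z^2 * z" by Groebner_Basis.algebra
    ultimately show ?thesis
      unfolding z2 by (simp add: zab complex_eq_iff algebra_simps power2_eq_square)
  qed
  have z4: "z^4 = Complex (8 * a^4 - 8 * a^2 + 1) ((8 * a^3 - 4 * a) * b)"
  proof -
    have "(2 * a^2 - 1) * (2 * a^2 - 1) - 2 * a * b * (2 * a * b) = 8 * a^4 - 8 * a^2 + 1"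
      using ab by Groebner_Basis.algebra
    moreover have "z^4 = z^2 * z^2" by Groebner_Basis.algebra
    ultimately show ?thesis
      unfolding z2 by (simp add: complex_eq_iff algebra_simps power2_eq_square power3_eq_cube)
  qed
  have p: "Re p = A" "Im p = b * q"
    unfolding p_def z2 z3 z4 unfolding zab
    by (simp_all add: A_def q_def algebra_simps power2_eq_square power3_eq_cube)
  have "7 * (cmod (of_real (3 + 2 * t^2) * p - 28 * of_real t))^2 - 5 * (cmod (42 - 5 * of_real t * p))^2
    = 7 * (((3 + 2 * t^2) * A - 28 * t)^2 + ((3 + 2 * t^2) * q)^2 * b^2)
      - 5 * ((42 - 5 * t * A)^2 + (5 * t * q)^2 * b^2)"
    by (simp add: cmod_power2 p power_mult_distrib)
  also have "\<dots> = (252 + 4960 * t^2 - 1852 * t^4 - 49 * t^6 - 41 * t^8 + 28 * t^10)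
     + (- 1008 * t - 12120 * t^3 + 3200 * t^5 + 552 * t^7 - 224 * t^9) * a
     + (- 2688 * t^2 + 14080 * t^4 - 2208 * t^6 + 896 * t^8) * a^2
     + (8736 * t^3 - 8608 * t^5 - 2688 * t^7) * a^3
     + (- 7392 * t^4 + 6272 * t^6) * a^4"
    unfolding ab A_def q_def by Groebner_Basis.algebra
  finally show ?thesis .
qed

section \<open>The curve in the numerical range\<close>

text \<open>The polynomial \<open>F\<close>; the coefficients come from the autocorrelations \<open>12, 8, 4, 1\<close> of
  \<open>(1, 2, 2, 2, 1)\<close>, whose squared length is \<open>14\<close>.\<close>
definition range_curve :: "real \<Rightarrow> complex \<Rightarrow> complex" where
  "range_curve t z = of_real t + of_real (1 - t^2) *
     (12 * z - 8 * of_real t * z^2 + 4 * of_real t^2 * z^3 - of_real t^3 * z^4) / 14"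

lemma range_curve_in_numerical_range:
  assumes z: "cmod z = 1"
  shows "range_curve t z \<in> numerical_range (M_Theta 5 t)"
proof -
  define x where "x = (\<lambda>i::nat. [1,2,2,2,1] ! i :: complex)"
  define s where "s = complex_of_real (sqrt 14)"
  \<comment> \<open>This is \<open>diag(1, z, ..., z^4) x\<close> normalised. As
    \<open>|z| = 1\<close>, the term of the quadratic form at \<open>(i, j)\<close> with
    \<open>i \<le> j\<close> involves only \<open>z ^ (j - i)\<close>.\<close>
  define v where "v = vec 5 (\<lambda>i. x i * z ^ i / s)"
  have zz: "z * cnj z = 1" using z by (simp add: complex_norm_square[symmetric])
  have s: "s * s = 14" "cnj s = s"
    unfolding s_def by (metis of_real_mult of_real_numeral real_sqrt_mult_self abs_numeral) simp
  have s0: "s \<noteq> 0" using s by auto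
  have x: "x 0 = 1" "x (Suc 0) = 2" "x 2 = 2" "x 3 = 2" "x 4 = 1" by (simp_all add: x_def)
  have cx: "cnj (x i) = x i" if "i < 5" for i
    using that by (auto simp: x_def less_Suc_eq numeral_eq_Suc)
  have S: "(\<Sum>i = 0..<5. f i) = f 0 + f 1 + f 2 + f 3 + f (4::nat)" for f :: "nat \<Rightarrow> complex"
    by (simp add: eval_nat_numeral)
  have zp: "z ^ (i + k) * cnj z ^ i = z ^ k" for i k
    using zz by (simp add: power_add mult.assoc[symmetric] power_mult_distrib[symmetric] mult.commute)
  have zij: "z ^ j * cnj z ^ i = z ^ (j - i)" if "i \<le> j" for i j
    using zp[of i "j - i"] that by simp
  have entry: "x j * z ^ j / s * cnj (x i * z ^ i / s) = x i * x j * z ^ (j - i) / 14" if "i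
      \<le> j" "i < 5" for i j
    using zij[OF that(1)] s cx[OF that(2)] by (simp add: field_simps s0)
  have "v \<bullet>c v = (\<Sum>i=0..<5. x i * z ^ i / s * cnj (x i * z ^ i / s))"
    unfolding scalar_prod_def by (intro sum.cong) (simp_all add: v_def)
  also have "\<dots> = (\<Sum>i=0..<5. x i * x i * z ^ (i - i) / 14)"
    by (intro sum.cong refl entry) auto
  also have "\<dots> = 1" by (simp add: S x)
  finally have n: "v \<bullet>c v = 1" .
  let ?m = "\<lambda>i j. if i = j then of_real t
     else if i < j then of_real ((1 - t\<^sup>2) * (- t) ^ (j - i - 1)) else (0::complex)"
  have "(M_Theta 5 t *\<^sub>v v) \<bullet>c v
      = (\<Sum>i=0..<5. (\<Sum>j=0..<5. ?m i j * (x j * z ^ j / s)) * cnj (x i * z ^ i / s))"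
    unfolding scalar_prod_def by (intro sum.cong)
        (simp_all add: M_Theta_def v_def mult_mat_vec_def row_def scalar_prod_def)
  also have "\<dots> = (\<Sum>i=0..<5. \<Sum>j=0..<5. ?m i j * (x i * x j * z ^ (j - i) / 14))"
  proof (intro sum.cong refl)
    fix i :: nat assume i: "i \<in> {0..<5}"
    have "?m i j * (x j * z ^ j / s) * cnj (x i * z ^ i / s) = ?m i j * (x i * x j * z ^ (j - i) / 14)" for j
    proof (cases "i \<le> j")
      case True
      then have "x j * z ^ j / s * cnj (x i * z ^ i / s) = x i * x j * z ^ (j - i) / 14"
        using i by (intro entry) auto
      then show ?thesis by (simp only: mult.assoc)
    qed auto
    then show "(\<Sum>j=0..<5. ?m i j * (x j * z ^ j / s)) * cnj (x i * z ^ i / s) =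
      (\<Sum>j=0..<5. ?m i j * (x i * x j * z ^ (j - i) / 14))"
      unfolding sum_distrib_right by (intro sum.cong refl)
  qed
  also have "\<dots> = range_curve t z"
    by (simp add: S x range_curve_def field_simps power2_eq_square power3_eq_cube)
  finally have "(M_Theta 5 t *\<^sub>v v) \<bullet>c v = range_curve t z" .
  moreover have "v \<in> carrier_vec (dim_row (M_Theta 5 t))" by (simp add: v_def M_Theta_def)
  moreover have "vec_norm v = 1" using n by (simp add: vec_norm_def)
  ultimately show ?thesis
    unfolding numerical_range_def by (intro CollectI exI[of _ v]) auto
qed

text \<open>Homogeneous form of the identity by which \<open>(z + t) / (1 + t * z)\<close> maps the
  unit disk to itself; applied to each coordinate, it makes \<open>\<phi>(z J)\<close> a
  contraction.\<close>

lemma cmod_shift_diff: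
  fixes t :: real
  shows "(cmod (a + of_real t * b))^2 - (cmod (of_real t * a + b))^2 = (1 - t^2) * ((cmod a)^2 - (cmod b)^2)"
  unfolding cmod_power2 by (simp add: algebra_simps power2_eq_square)

text \<open>This keeps \<open>F\<close> away from the poles of \<open>B\<close> and the zeros of
  \<open>1 - c * F\<close>. It holds because \<open>\<phi>(z J)\<close> is a contraction, proved
  here coordinatewise.\<close>

lemma cmod_range_curve_le_1:
  assumes t: "0 \<le> t" "t < 1" and z: "cmod z \<le> 1"
  shows "cmod (range_curve t z) \<le> 1"
proof -
  \<comment> \<open>\<open>y = (1 + t z J)^(-1) x\<close> and \<open>w = (t + z J) y = \<phi>(z J) x\<close> for the unnormalised \<open>x = (1, 2, 2, 2, 1)\<close>\<close>
  define y5 where "y5 = (1::complex)"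
  define y4 where "y4 = 2 - of_real t * (z * y5)"
  define y3 where "y3 = 2 - of_real t * (z * y4)"
  define y2 where "y2 = 2 - of_real t * (z * y3)"
  define y1 where "y1 = 1 - of_real t * (z * y2)"
  note ys = y1_def y2_def y3_def y4_def y5_def
  define w1 where "w1 = of_real t * y1 + z * y2"
  define w2 where "w2 = of_real t * y2 + z * y3"
  define w3 where "w3 = of_real t * y3 + z * y4"
  define w4 where "w4 = of_real t * y4 + z * y5"
  define w5 where "w5 = of_real t * y5"
  note ws = w1_def w2_def w3_def w4_def w5_def
  have "14 * range_curve t z = 14 * of_real t + (1 - of_real t^2) *
     (12 * z - 8 * of_real t * z^2 + 4 * of_real t^2 * z^3 - of_real t^3 * z^4)"
    by (simp add: range_curve_def)
  also have "\<dots> = w1 + 2 * w2 + 2 * w3 + 2 * w4 + w5"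
    unfolding ws ys by Groebner_Basis.algebra
  finally have eq: "14 * range_curve t z = w1 + 2 * w2 + 2 * w3 + 2 * w4 + w5" .
  have sq: "(cmod (z * y))^2 \<le> (cmod y)^2" for y
    using z by (simp add: norm_mult mult_left_le_one_le power_mono)
  have step: "(cmod (of_real t * y + z * y'))^2
      \<le> (cmod (y + of_real t * (z * y')))^2 - (1 - t^2) * ((cmod y)^2 - (cmod y')^2)" for y y'
  proof -
    have "(1 - t^2) * ((cmod y)^2 - (cmod y')^2) \<le> (1 - t^2) * ((cmod y)^2 - (cmod (z * y'))^2)"
      using t sq[of y'] by (intro mult_left_mono) (auto simp: power_le_one)
    then show ?thesis using cmod_shift_diff[of y t "z * y'"] by simp
  qed
  \<comment> \<open>Adding these telescopes to \<open>14 - (1 - t^2) * (cmod y1)^2\<close>.\<close>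
  have c: "(cmod w1)^2 \<le> 1 - (1 - t^2) * ((cmod y1)^2 - (cmod y2)^2)"
    "(cmod w2)^2 \<le> 4 - (1 - t^2) * ((cmod y2)^2 - (cmod y3)^2)"
    "(cmod w3)^2 \<le> 4 - (1 - t^2) * ((cmod y3)^2 - (cmod y4)^2)"
    "(cmod w4)^2 \<le> 4 - (1 - t^2) * ((cmod y4)^2 - (cmod y5)^2)"
    "(cmod w5)^2 = 1 - (1 - t^2) * (cmod y5)^2"
    using step[of y1 y2] step[of y2 y3] step[of y3 y4] step[of y4 y5]
    by (simp_all add: ws y1_def y2_def y3_def y4_def) (simp_all add: y5_def norm_mult)
  have "(1 - t^2) * (cmod y1)^2 \<ge> 0" using t by (simp add: power_le_one)
  then have sum: "(cmod w1)^2 + (cmod w2)^2 + (cmod w3)^2 + (cmod w4)^2 + (cmod w5)^2 \<le> 14"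
    using c by (simp add: algebra_simps)
  \<comment> \<open>Replaces Cauchy-Schwarz: \<open>w\<close> and \<open>x\<close> both have squared
    length at most 14.\<close>
  have amgm: "cmod w \<le> (1 + (cmod w)^2) / 2" "2 * cmod w \<le> (4 + (cmod w)^2) / 2" for w
    using zero_le_power2[of "cmod w - 1"] zero_le_power2[of "cmod w - 2"]
    by (simp_all add: power2_diff)
  have "cmod (14 * range_curve t z) \<le> cmod w1 + 2 * cmod w2 + 2 * cmod w3 + 2 * cmod w4 + cmod w5"
    unfolding eq by (intro norm_triangle_le add_mono) (simp_all add: norm_mult)
  also have "\<dots> \<le> 14"
    using amgm(1)[of w1] amgm(2)[of w2] amgm(2)[of w3] amgm(2)[of w4] amgm(1)[of w5] sum by argo
  finally show ?thesis by (simp add: norm_mult)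
qed

section \<open>The pseudohyperbolic disk covered by the curve's interior\<close>

lemma disk_center_abs_lt_1:
  fixes t :: real
  assumes t: "0 \<le> t" "t < 1"
  shows "\<bar>5 * t / (3 + 2 * t^2)\<bar> < 1"
proof -
  have "3 + 2 * t^2 > 0" by (simp add: add_pos_nonneg)
  moreover have "0 < (1 - t) * (3 - 2 * t)" using t by simp
  then have "5 * t < 3 + 2 * t^2" by (simp add: algebra_simps power2_eq_square)
  ultimately show ?thesis using t by simp
qed

lemma range_curve_avoids_disk:
  assumes t: "0 \<le> t" "t < 1" and z: "cmod z = 1"
  defines "c \<equiv> 5 * t / (3 + 2 * t^2)"
  assumes u: "cmod u \<le> 16 / 19"
  shows "range_curve t z \<noteq> disk_map c u"
proof
  assume eq: "range_curve t z = disk_map c u"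
  \<comment> \<open>Membership in the disk contradicts \<open>|F - c|\<^sup>2 \<ge> 5/7 |1 - c F|\<^sup>2\<close>, as \<open>(16/19)\<^sup>2 < 5/7\<close>.\<close>
  let ?F = "range_curve t z"
  define p where "p = 12 * z - 8 * of_real t * z^2 + 4 * of_real t^2 * z^3 - of_real t^3 * z^4"
  have D: "3 + 2 * t^2 > 0" by (simp add: add_pos_nonneg)
  have c: "\<bar>c\<bar> < 1" unfolding c_def by (rule disk_center_abs_lt_1[OF t])
  have nz: "1 + of_real c * u \<noteq> 0" using disk_map_denominator_nonzero[OF c] u by simp
  have "?F * (1 + of_real c * u) = u + of_real c"
    using nz by (simp add: eq disk_map_def)
  then have "?F - of_real c = u * (1 - of_real c * ?F)"
    by Groebner_Basis.algebra
  then have le: "cmod (?F - of_real c) \<le> 16 / 19 * cmod (1 - of_real c * ?F)"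
    using u by (simp only: norm_mult mult_right_mono norm_ge_zero)
  have F: "14 * ?F = 14 * of_real t + (1 - of_real t^2) * p"
    by (simp add: range_curve_def p_def)
  have "c * (3 + 2 * t^2) = 5 * t"
    using D by (simp add: c_def)
  from arg_cong[OF this, of complex_of_real]
  have cD: "of_real c * (3 + 2 * of_real t^2) = (5 * of_real t :: complex)"
    by simp
  have "14 * (3 + 2 * of_real t^2) * (?F - of_real c)
      = (1 - of_real t^2) * ((3 + 2 * of_real t^2) * p - 28 * of_real t)"
    using F cD by Groebner_Basis.algebra
  then have "of_real (14 * (3 + 2 * t^2)) * (?F - of_real c)
      = of_real (1 - t^2) * (of_real (3 + 2 * t^2) * p - 28 * of_real t)"
    by simp
  moreover have "14 * (3 + 2 * of_real t^2) * (1 - of_real c * ?F)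
      = (1 - of_real t^2) * (42 - 5 * of_real t * p)"
    using F cD by Groebner_Basis.algebra
  then have "of_real (14 * (3 + 2 * t^2)) * (1 - of_real c * ?F)
      = of_real (1 - t^2) * (42 - 5 * of_real t * p)"
    by simp
  moreover have "0 \<le> 7 * (cmod (of_real (3 + 2 * t^2) * p - 28 * of_real t))^2
      - 5 * (cmod (42 - 5 * of_real t * p))^2"
    unfolding p_def separation_identity[OF z]
    by (rule separation_polynomial_nonneg) (use t z abs_Re_le_cmod[of z] in auto)
  then have "0 \<le> (1 - t^2)^2 * (7 * (cmod (of_real (3 + 2 * t^2) * p - 28 * of_real t))^2
      - 5 * (cmod (42 - 5 * of_real t * p))^2)"
    by simp
  then have "5 * (cmod (of_real (1 - t^2) * (42 - 5 * of_real t * p)))^2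
      \<le> 7 * (cmod (of_real (1 - t^2) * (of_real (3 + 2 * t^2) * p - 28 * of_real t)))^2"
    unfolding norm_mult norm_of_real power_mult_distrib power2_abs
    by (simp add: algebra_simps)
  ultimately have "5 * (cmod (of_real (14 * (3 + 2 * t^2)) * (1 - of_real c * ?F)))^2
      \<le> 7 * (cmod (of_real (14 * (3 + 2 * t^2)) * (?F - of_real c)))^2"
    by simp
  then have "(14 * (3 + 2 * t^2))^2 * (5 * (cmod (1 - of_real c * ?F))^2)
      \<le> (14 * (3 + 2 * t^2))^2 * (7 * (cmod (?F - of_real c))^2)"
    unfolding norm_mult norm_of_real power_mult_distrib power2_abs
    by (simp add: algebra_simps)
  then have "5 * (cmod (1 - of_real c * ?F))^2 \<le> 7 * (cmod (?F - of_real c))^2"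
    using D by (subst (asm) mult_le_cancel_left_pos) auto
  also have "\<dots> \<le> 7 * (16 / 19 * cmod (1 - of_real c * ?F))^2"
    using le by (intro mult_left_mono power_mono) auto
  \<comment> \<open>Since \<open>7 * (16 / 19)^2 < 5\<close>, only \<open>1 - c * F = 0\<close>
    remains, which \<open>|c| < 1\<close> and \<open>|F| \<le> 1\<close> exclude.\<close>
  finally have "cmod (1 - of_real c * ?F) ^ 2 \<le> 0"
    by (simp add: power_mult_distrib power_divide)
  moreover have "1 + of_real (- c) * ?F \<noteq> 0"
    using disk_map_denominator_nonzero[of "- c"] c cmod_range_curve_le_1[OF t] z by auto
  ultimately show False by simp
qed

text \<open>As \<open>U\<close> misses the image of the unit circle, the disjoint open sets
  \<open>F(D)\<close> and the complement of the image of the closed disk cover it. Being connected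
  and meeting the first, \<open>U\<close> lies in it.\<close>

lemma disk_subset_range_curve:
  assumes t: "0 \<le> t" "t < 1"
  defines "c \<equiv> 5 * t / (3 + 2 * t^2)"
  shows "disk_map c ` cball 0 (16 / 19) \<subseteq> range_curve t ` ball 0 1"
proof -
  let ?F = "range_curve t"
  let ?U = "disk_map c ` cball 0 (16 / 19)"
  have D: "3 + 2 * t^2 > 0" by (simp add: add_pos_nonneg)
  have c: "\<bar>c\<bar> < 1" unfolding c_def by (rule disk_center_abs_lt_1[OF t])
  have t2: "t^2 < 1" using t by (simp add: power_less_one_iff)
  have holF: "?F holomorphic_on A" for A
    unfolding range_curve_def by (intro holomorphic_intros) auto
  have "continuous_on (cball 0 (16 / 19)) (disk_map c)"
    unfolding disk_map_def using disk_map_denominator_nonzero[OF c]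
    by (intro continuous_intros) auto
  then have conn: "connected ?U"
    by (intro connected_continuous_image) auto
  have "?F 1 \<noteq> ?F 0"
  proof
    have "t^3 \<le> 1" using t by (simp add: power_le_one)
    then have "12 - 8 * t + 4 * t^2 - t^3 > 0"
      using t zero_le_power2[of t] by linarith
    then have "(1 - t^2) * (12 - 8 * t + 4 * t^2 - t^3) \<noteq> 0"
      using t2 by simp
    moreover assume "?F 1 = ?F 0"
    then have "of_real ((1 - t^2) * (12 - 8 * t + 4 * t^2 - t^3)) = (0 :: complex)"
      by (simp add: range_curve_def)
    ultimately show False by (simp only: of_real_eq_0_iff)
  qed
  then have "\<not> ?F constant_on UNIV"
    by (metis constant_on_def UNIV_I)
  then have op: "open (?F ` ball 0 1)"
    by (intro open_mapping_thm[OF holF]) auto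
  have cl: "open (- ?F ` cball 0 1)"
    by (intro open_Compl compact_imp_closed compact_continuous_image holomorphic_on_imp_continuous_on holF) auto
  have cover: "?U \<subseteq> ?F ` ball 0 1 \<union> - ?F ` cball 0 1"
  proof
    fix w assume "w \<in> ?U"
    then obtain u where u: "cmod u \<le> 16 / 19" "w = disk_map c u" by auto
    show "w \<in> ?F ` ball 0 1 \<union> - ?F ` cball 0 1"
    proof (cases "w \<in> ?F ` cball 0 1")
      case True
      then obtain z where z: "cmod z \<le> 1" "w = ?F z" by auto
      then have "cmod z \<noteq> 1"
        using range_curve_avoids_disk[OF t _ u(1)] u(2) unfolding c_def by metis
      then show ?thesis using z by auto
    qed auto
  qed
  have "?F ` ball 0 1 \<inter> ?U \<noteq> {}"
  proof -
    have "9 - 4 * t^2 > 0" using t2 by simp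
    \<comment> \<open>The center is \<open>c = disk_map t (2 * t / 3)\<close>, so
      \<open>disk_map c\<close> sends \<open>- 2 * t / 3\<close> to \<open>t\<close>; moreover
      \<open>2 / 3 < 16 / 19\<close>.\<close>
    have "disk_map c (of_real (- 2 * t / 3)) = of_real ((- 2 * t / 3 + c) / (1 + c * (- 2 * t / 3)))"
      by (simp add: disk_map_def)
    also have "(- 2 * t / 3 + c) / (1 + c * (- 2 * t / 3)) = t"
    proof -
      have "3 * (3 + 2 * t^2) * (- 2 * t / 3 + c) = t * (9 - 4 * t^2)"
        using D by (simp add: c_def field_simps power2_eq_square)
      moreover have "3 * (3 + 2 * t^2) * (1 + c * (- 2 * t / 3)) = 9 - 4 * t^2"
        using D by (simp add: c_def field_simps power2_eq_square)
      ultimately show ?thesis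
        using D \<open>9 - 4 * t^2 > 0\<close>
        by (smt (verit) mult_divide_mult_cancel_left nonzero_mult_div_cancel_right)
    qed
    also have "of_real t = ?F 0" by (simp add: range_curve_def)
    finally have "?F 0 = disk_map c (of_real (- 2 * t / 3))" ..
    moreover have "of_real (- 2 * t / 3) \<in> cball (0::complex) (16 / 19)"
      using t by (simp add: norm_mult norm_divide)
    moreover have "?F 0 \<in> ?F ` ball 0 1" by simp
    ultimately show ?thesis by blast
  qed
  moreover have "?F ` ball 0 1 \<inter> - ?F ` cball 0 1 \<inter> ?U = {}" by force
  ultimately have "- ?F ` cball 0 1 \<inter> ?U = {}"
    using connectedD[OF conn op cl _ cover] by blast
  then show ?thesis using cover by blast
qed

section \<open>The contradiction for Blaschke products of degree at most 4\<close>

theorem corollary2p2: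
  fixes t :: real
  assumes "0 \<le> t" and "t < 1"
  shows "level_set_crouzeix (M_Theta 5 t)"
  unfolding level_set_crouzeix_def
proof (intro allI impI notI)
  fix d B
  assume d: "d < dim_row (M_Theta 5 t)" and B: "finite_blaschke_product d B"
    and sub: "numerical_range (M_Theta 5 t) \<subseteq> level_set (1 / 2) B"
  let ?F = "range_curve t"
  define c where "c = 5 * t / (3 + 2 * t^2)"
  have c: "\<bar>c\<bar> < 1" unfolding c_def by (rule disk_center_abs_lt_1[OF assms])
  obtain l b where b: "\<And>j. j < d \<Longrightarrow> cmod (b j) < 1"
    and Bdef: "B = (\<lambda>z. l * (\<Prod>j<d. (z - b j) / (1 - cnj (b j) * z)))"
    using B unfolding finite_blaschke_product_def by blast
  have nz: "1 - cnj (b j) * ?F z \<noteq> 0" if "j < d" "cmod z \<le> 1" for j z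
    using one_minus_mult_nonzero[of "cnj (b j)" "?F z"] b[OF that(1)]
      cmod_range_curve_le_1[OF assms that(2)] by simp
  have hol: "(\<lambda>z. B (?F z)) holomorphic_on cball 0 1"
    unfolding Bdef
    by (intro holomorphic_intros nz) (auto simp: range_curve_def intro!: holomorphic_intros)
  have bound: "cmod (B (?F z)) \<le> 1 / 2" if "cmod z \<le> 1" for z
  proof (rule maximum_modulus_frontier[of "\<lambda>z. B (?F z)" "cball 0 1"])
    show "(\<lambda>z. B (?F z)) holomorphic_on interior (cball 0 1)"
      using hol holomorphic_on_subset interior_subset by blast
    show "continuous_on (closure (cball 0 1)) (\<lambda>z. B (?F z))"
      using hol by (simp add: holomorphic_on_imp_continuous_on)
    show "cmod (B (?F z)) \<le> 1 / 2" if "z \<in> frontier (cball 0 1)" for z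
      using that range_curve_in_numerical_range[of z t] sub by (auto simp: level_set_def)
  qed (use that in auto)
  \<comment> \<open>The radius lies in the narrow gap between \<open>2 powr (- 1 / 4)\<close>, about
    0.8409, needed for degree 4, and \<open>sqrt (5 / 7)\<close>, about 0.8452, allowed by the
    separation.\<close>
  have "(16 / 19) ^ d \<le> (1 / 2 :: real)"
  proof (rule blaschke_disk_bound[OF B c])
    fix u :: complex assume "cmod u = 16 / 19"
    then have "disk_map c u \<in> ?F ` ball 0 1"
      using disk_subset_range_curve[OF assms] unfolding c_def by auto
    then show "cmod (B (disk_map c u)) \<le> 1 / 2" using bound by auto
  qed auto
  moreover have "(16 / 19 :: real) ^ 4 \<le> (16 / 19) ^ d"
    using d by (intro power_decreasing) (auto simp: M_Theta_def)
  moreover have "1 / 2 < (16 / 19 :: real) ^ 4" by (simp add: power_divide)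
  ultimately show False by linarith
qed

end
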